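(* There exist a constant $n_0\in\mathbb{N}$ and a global constant $\epsilon_0 > 0$ such that for every positive integer $n \geq n_0$ there is a data matrix $\mathbf{X}$ with $n$ rows and $d$ columns (with label vector $\mathbf{y}=(-1,\dots,-1)$) for which any data structure $\tilde{\mathcal{L}}(\cdot)$ that, with probability at least $2/3$, satisfies, for a fixed (arbitrary) query $\beta\in\mathbb{R}^d$, $$(1-\epsilon_0)\mathcal{L}(\beta; \mathbf{X}) \leq \tilde{\mathcal{L}}(\beta; \mathbf{X}) \leq (1+\epsilon_0)\mathcal{L}(\beta; \mathbf{X}),$$ requires at least $\tilde{\Omega}(d\cdot \mu_\mathbf{y}(\mathbf{X}))$ bits of space.
   Context: With labels normalized to $\mathbf{y}_i=-1$, the logistic loss is $\mathcal{L}(\beta;\mathbf{X}) = \sum_{i=1}^n \log(1 + e^{\mathbf{x}_i^T\beta})$, where $\mathbf{x}_i^T$ are the rows of $\mathbf{X}$. The complexity measure is $\mu_\mathbf{y}(\mathbf{X}) = \sup_{\beta \neq 0} \frac{\|(\mathbf{D}_\mathbf{y}\mathbf{X}\beta)^+\|_1}{\|(\mathbf{D}_\mathbf{y}\mathbf{X}\beta)^-\|_1}$, with $\mathbf{D}_\mathbf{y}$ the diagonal matrix with diagonal $\mathbf{y}$ and $(\mathbf{v})^+$, $(\mathbf{v})^-$ the positive entries and absolute values of negative entries of $\mathbf{v}$. A data structure is any stored bit representation with an arbitrary (unbounded-time, possibly randomized) query procedure returning a real number for each query $\beta$; space is the number of stored bits. Entries of $\mathbf{X}$ are specifiable in $\mathcal{O}(\log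 nd)$ bits. $\tilde{\Omega}$ suppresses logarithmic factors in $n$, $d$, and $\mu_\mathbf{y}(\mathbf{X})$.
   Formalization: The query procedure is fixed before the data matrix X (X may depend on it; the stored bits may depend on X), since for a single fixed X a procedure with X built in would answer every query with 0 stored bits. *)

theory Defs
  imports "HOL-Probability.Probability" "Jordan_Normal_Form.Matrix"
begin

unbundle no vec_syntax
no_notation inner (infix "\<bullet>" 70)

type_synonym rvec = "real Matrix.vec"
type_synonym rmat = "real Matrix.mat"

section \<open>Logistic loss and the complexity measure\<close>

text \<open>All labels are normalized to \<open>-1\<close>.\<close>

definition logistic_loss :: "rmat \<Rightarrow> rvec \<Rightarrow> real" where
  "logistic_loss X \<beta> = (\<Sum>i<dim_row X. ln (1 + exp (row X i \<bullet> \<beta>)))"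

definition norm1 :: "rvec \<Rightarrow> real" where
  "norm1 v = (\<Sum>i<dim_vec v. \<bar>v $ i\<bar>)"

definition pos_part :: "rvec \<Rightarrow> rvec" where
  "pos_part v = map_vec (\<lambda>a. max a 0) v"

definition neg_part :: "rvec \<Rightarrow> rvec" where
  "neg_part v = map_vec (\<lambda>a. max (- a) 0) v"

text \<open>Division is that of \<^typ>\<open>ennreal\<close>: a quotient \<open>a / 0\<close> with \<open>a > 0\<close> is infinite, while a
  direction \<open>\<beta>\<close> in the kernel of \<open>X\<close> gives \<open>0 / 0 = 0\<close> and so does not affect the supremum.\<close>

definition complexity :: "rvec \<Rightarrow> rmat \<Rightarrow> ennreal" where
  "complexity y X =
     (SUP \<beta>\<in>carrier_vec (dim_col X) - {0\<^sub>v (dim_col X)}.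
        let v = (mat_diag (dim_row X) (\<lambda>i. y $ i) * X) *\<^sub>v \<beta>
        in ennreal (norm1 (pos_part v)) / ennreal (norm1 (neg_part v)))"

text \<open>Entries specifiable in \<open>O(log (n d))\<close> bits: fractions whose numerator and denominator
  are bounded by a fixed power of \<open>n d\<close>.\<close>

definition short_entries :: "nat \<Rightarrow> rmat \<Rightarrow> bool" where
  "short_entries C X \<longleftrightarrow>
     (\<forall>i<dim_row X. \<forall>j<dim_col X. \<exists>p q :: int.
        0 < q \<and> q \<le> int ((dim_row X * dim_col X) ^ C) \<and>
        \<bar>p\<bar> \<le> int ((dim_row X * dim_col X) ^ C) \<and>
        X $$ (i, j) = of_int p / of_int q)"

section \<open>Data structures\<close>

text \<open>A data structure consists of a (possibly random) stored bit string \<open>S\<close> and a query procedure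
  \<open>Q\<close>, which maps a bit string and a query vector to a random real number and has no other access
  to the data. No computability or running time constraint is imposed on either. The random choices
  of \<open>Q\<close> are independent of those made when storing, except through the stored bits.

  In a lower bound \<open>Q\<close> must be fixed before the data matrix \<open>X\<close>: a procedure chosen for one
  particular matrix could have that matrix built in and would need no stored bits at all.\<close>

type_synonym query_proc = "bool list \<Rightarrow> rvec \<Rightarrow> real measure"

definition query_procedure :: "query_proc \<Rightarrow> bool" where
  "query_procedure Q \<longleftrightarrow> (\<forall>s \<beta>. Q s \<beta> \<in> space (prob_algebra borel))"

definition answer :: "bool list pmf \<Rightarrow> query_proc \<Rightarrow> rvec \<Rightarrow> real measure" where
  "answer S Q \<beta> = measure_pmf S \<bind> (\<lambda>s. Q s \<beta>)"

definition approximates_loss :: "real \<Rightarrow> rmat \<Rightarrow> bool list pmf \<Rightarrow> query_proc \<Rightarrow> bool" where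
  "approximates_loss \<epsilon> X S Q \<longleftrightarrow>
     (\<forall>\<beta>\<in>carrier_vec (dim_col X).
        measure (answer S Q \<beta>)
          {(1 - \<epsilon>) * logistic_loss X \<beta> .. (1 + \<epsilon>) * logistic_loss X \<beta>} \<ge> 2 / 3)"

definition stored_in_bits :: "nat \<Rightarrow> bool list pmf \<Rightarrow> bool" where
  "stored_in_bits b S \<longleftrightarrow> (\<forall>s\<in>set_pmf S. length s \<le> b)"

end

theory Submission
  imports Defs
begin

text \<open>
  With \<open>m = n - 1\<close>, a set \<open>B \<subseteq> {..<m}\<close> is encoded in the rows \<open>(s\<^sub>j, c\<^sub>j)\<close> for \<open>j < m\<close>, where
  \<open>s\<^sub>j\<close> is the \<open>\<plusminus>1\<close>-vector of the \<open>D \<approx> log n\<close> binary digits of \<open>j\<close>, and \<open>c\<^sub>j\<close> is \<open>1\<close> if \<open>j \<in> B\<close> and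
  \<open>2\<close> otherwise. Distinct sign vectors have inner product at most \<open>D - 2\<close>, so at the query
  \<open>T (s\<^sub>i, 1 - D)\<close> the only row of these with a positive value is row \<open>i\<close>, and it is so only if
  \<open>i \<in> B\<close>; all other values are at most \<open>- T\<close>.

  One more row, minus the sum of the others divided by \<open>K = 8 (D + 1) m\<close>, makes the complexity
  equal to \<open>K\<close>, while its value at a query stays below \<open>3 T / 8\<close>. Hence a \<open>1/4\<close>-approximation of the
  loss decides membership in \<open>B\<close>. Averaging over the stored string, some string of at most \<open>b\<close> bits
  yields probabilities \<open>p\<^sub>i\<close> at \<open>l\<^sub>1\<close>-distance at most \<open>m / 3\<close> from the indicator of \<open>B\<close>. A given
  string serves at most \<open>(2\<^bsup>1/3\<^esup> \<cdot> 3/2)\<^bsup>m\<^esup>\<close> of the \<open>2\<^bsup>m\<^esup>\<close> sets, which forces \<open>b = \<Omega>(m)\<close>.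
\<close>

section \<open>Complexity of balanced matrices\<close>

lemma norm1_pos_part: "norm1 (pos_part v) = (\<Sum>i<dim_vec v. max (v $ i) 0)"
  by (auto simp: norm1_def pos_part_def intro!: sum.cong)

lemma norm1_neg_part: "norm1 (neg_part v) = (\<Sum>i<dim_vec v. max (- v $ i) 0)"
  by (auto simp: norm1_def neg_part_def intro!: sum.cong)

lemma ennreal_divide_le_of_le_mult:
  fixes a b K :: real
  assumes "0 \<le> a" "0 \<le> b" "0 \<le> K" "a \<le> K * b"
  shows "ennreal a / ennreal b \<le> ennreal K"
proof (cases "b = 0")
  case True
  then have "a = 0" using assms by simp
  then show ?thesis by simp
next
  case False
  with assms have "b > 0" by simp
  with assms show ?thesis
    by (simp add: divide_ennreal ennreal_leI pos_divide_le_eq)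
qed

text \<open>With all labels -1 the diagonal factor is minus the identity, so the negative parts of
  \<open>X *\<^sub>v \<beta>\<close> end up in the numerator.\<close>

lemma complexity_all_negative:
  assumes X: "X \<in> carrier_mat n d"
  shows "complexity (Matrix.vec n (\<lambda>_. - 1)) X =
    (SUP \<beta>\<in>carrier_vec d - {0\<^sub>v d}.
       ennreal (\<Sum>i<n. max (- (row X i \<bullet> \<beta>)) 0) / ennreal (\<Sum>i<n. max (row X i \<bullet> \<beta>) 0))"
proof -
  define A where "A = mat_diag n (\<lambda>i. Matrix.vec n (\<lambda>_. - 1 :: real) $ i) * X"
  have A: "dim_row A = n"
    by (simp add: A_def mat_diag_def)
  have entry: "(A *\<^sub>v \<beta>) $ i = - (row X i \<bullet> \<beta>)" if "i < n" "\<beta> \<in> carrier_vec d" for i \<beta>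
    using that X
    by (simp add: A_def mat_diag_mult_left[OF X] scalar_prod_def flip: sum_negf)
  have "complexity (Matrix.vec n (\<lambda>_. - 1)) X = (SUP \<beta>\<in>carrier_vec d - {0\<^sub>v d}.
      ennreal (norm1 (pos_part (A *\<^sub>v \<beta>))) / ennreal (norm1 (neg_part (A *\<^sub>v \<beta>))))"
    using X by (simp add: complexity_def Let_def A_def)
  also have "\<dots> = (SUP \<beta>\<in>carrier_vec d - {0\<^sub>v d}.
       ennreal (\<Sum>i<n. max (- (row X i \<bullet> \<beta>)) 0) / ennreal (\<Sum>i<n. max (row X i \<bullet> \<beta>) 0))"
    by (intro SUP_cong refl) (simp add: norm1_pos_part norm1_neg_part A entry del: index_mult_mat_vec)
  finally show ?thesis .
qed

text \<open>Let \<open>P\<close> and \<open>N\<close> be the positive and negative mass of the first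
  \<open>m\<close> rows; the last row has the value \<open>(N - P) / K\<close>. If
  \<open>P \<le> N\<close>, the denominator \<open>P + (N - P) / K\<close> is at least
  \<open>N / K\<close> because \<open>K \<ge> 1\<close>; otherwise the numerator
  \<open>N + (P - N) / K\<close> is at most \<open>P\<close>. Either way the ratio is at most
  \<open>K\<close>, and a direction with \<open>P = 0 < N\<close> attains it.\<close>

lemma complexity_balanced:
  fixes K :: real
  assumes X: "X \<in> carrier_mat (Suc m) d" and K: "1 \<le> K"
    and bal: "\<And>\<beta>. \<beta> \<in> carrier_vec d \<Longrightarrow> row X m \<bullet> \<beta> = - (\<Sum>j<m. row X j \<bullet> \<beta>) / K"
    and \<beta>0: "\<beta>0 \<in> carrier_vec d" "\<And>j. j < m \<Longrightarrow> row X j \<bullet> \<beta>0 < 0" and m: "0 < m"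
  shows "complexity (Matrix.vec (Suc m) (\<lambda>_. - 1)) X = ennreal K"
proof -
  define P where "P \<beta> = (\<Sum>j<m. max (row X j \<bullet> \<beta>) 0)" for \<beta>
  define N where "N \<beta> = (\<Sum>j<m. max (- (row X j \<bullet> \<beta>)) 0)" for \<beta>
  have PN: "0 \<le> P \<beta>" "0 \<le> N \<beta>" "(\<Sum>j<m. row X j \<bullet> \<beta>) = P \<beta> - N \<beta>" for \<beta>
    by (auto simp: P_def N_def sum_nonneg max_def simp flip: sum_subtractf intro!: sum.cong)
  have last: "row X m \<bullet> \<beta> = (N \<beta> - P \<beta>) / K" if "\<beta> \<in> carrier_vec d" for \<beta>
    using bal[OF that] PN(3)[of \<beta>] by simp
  define R where "R \<beta> = ennreal (\<Sum>i<Suc m. max (- (row X i \<bullet> \<beta>)) 0) /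
      ennreal (\<Sum>i<Suc m. max (row X i \<bullet> \<beta>) 0)" for \<beta>
  have R: "R \<beta> = ennreal (N \<beta> + max ((P \<beta> - N \<beta>) / K) 0) /
      ennreal (P \<beta> + max ((N \<beta> - P \<beta>) / K) 0)" if "\<beta> \<in> carrier_vec d" for \<beta>
    unfolding R_def using last[OF that] by (simp add: P_def N_def diff_divide_distrib)
  have upper: "R \<beta> \<le> ennreal K" if \<beta>: "\<beta> \<in> carrier_vec d" for \<beta>
    unfolding R[OF \<beta>]
  proof (rule ennreal_divide_le_of_le_mult)
    show "N \<beta> + max ((P \<beta> - N \<beta>) / K) 0 \<le> K * (P \<beta> + max ((N \<beta> - P \<beta>) / K) 0)"
    proof (cases "P \<beta> \<le> N \<beta>")
      case True
      have "P \<beta> \<le> K * P \<beta>" using K PN(1)[of \<beta>] by (simp add: mult_le_cancel_right1)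
      with True K show ?thesis by (simp add: max_def divide_le_0_iff zero_le_divide_iff field_simps)
    next
      case False
      have "(P \<beta> - N \<beta>) / K \<le> P \<beta> - N \<beta>" using False K by (simp add: divide_le_eq mult_le_cancel_left1)
      moreover have "P \<beta> \<le> K * P \<beta>" using K PN(1)[of \<beta>] by (simp add: mult_le_cancel_right1)
      moreover have "max ((P \<beta> - N \<beta>) / K) 0 = (P \<beta> - N \<beta>) / K" "max ((N \<beta> - P \<beta>) / K) 0 = 0"
        using False K by (auto simp: max_def divide_le_0_iff zero_le_divide_iff)
      ultimately show ?thesis by simp
    qed
  qed (use PN K in \<open>auto intro!: add_nonneg_nonneg\<close>)
  have P0: "P \<beta>0 = 0"
    unfolding P_def using \<beta>0(2) by (intro sum.neutral) (auto simp: max_def not_le less_imp_le)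
  have "row X 0 \<bullet> \<beta>0 < 0" using \<beta>0(2) m by blast
  have N0: "0 < N \<beta>0"
    unfolding N_def using m \<beta>0(2) by (intro sum_pos) (auto simp: less_max_iff_disj)
  have "0 < N \<beta>0 / K" using N0 K by simp
  then have "R \<beta>0 = ennreal (N \<beta>0) / ennreal (N \<beta>0 / K)"
    using R[OF \<beta>0(1)] P0 by simp
  also have "\<dots> = ennreal K"
    using N0 K by (simp add: divide_ennreal)
  finally have attained: "R \<beta>0 = ennreal K" .
  have "\<beta>0 \<noteq> 0\<^sub>v d"
  proof
    assume "\<beta>0 = 0\<^sub>v d"
    then have "row X 0 \<bullet> \<beta>0 = 0" using X m by (simp add: scalar_prod_def)
    then show False using \<open>row X 0 \<bullet> \<beta>0 < 0\<close> by simp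
  qed
  then have "(SUP \<beta>\<in>carrier_vec d - {0\<^sub>v d}. R \<beta>) = ennreal K"
    using \<beta>0(1) attained upper by (intro antisym SUP_least SUP_upper2[of \<beta>0]) auto
  then show ?thesis
    using complexity_all_negative[OF X] by (simp add: R_def)
qed

section \<open>The hard matrices\<close>

definition code_entry :: "nat \<Rightarrow> nat set \<Rightarrow> nat \<Rightarrow> nat \<Rightarrow> int" where
  "code_entry D B j k = (if k < D then (if bit j k then 1 else - 1) else if j \<in> B then 1 else 2)"

text \<open>This is the intended complexity. At a probe the values of the first \<open>m\<close>
  rows sum to at least \<open>- 3 D T m\<close>, so division by more than \<open>8 D m\<close> keeps
  the last row below \<open>3 T / 8\<close>.\<close>

definition balance :: "nat \<Rightarrow> nat \<Rightarrow> nat" where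
  "balance D m = 8 * Suc D * m"

definition hard_mat :: "nat \<Rightarrow> nat \<Rightarrow> nat set \<Rightarrow> rmat" where
  "hard_mat D m B = Matrix.mat (Suc m) (Suc D) (\<lambda>(j, k).
     if j < m then of_int (code_entry D B j k)
     else of_int (- (\<Sum>i<m. code_entry D B i k)) / of_int (int (balance D m)))"

definition probe :: "nat \<Rightarrow> real \<Rightarrow> nat \<Rightarrow> rvec" where
  "probe D T i = Matrix.vec (Suc D)
     (\<lambda>k. T * (if k < D then (if bit i k then 1 else - 1) else 1 - real D))"

lemma hard_mat_carrier: "hard_mat D m B \<in> carrier_mat (Suc m) (Suc D)"
  by (simp add: hard_mat_def)

lemma probe_carrier: "probe D T i \<in> carrier_vec (Suc D)"
  by (simp add: probe_def)

lemma row_hard_mat: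
  assumes "j < m" "\<beta> \<in> carrier_vec (Suc D)"
  shows "row (hard_mat D m B) j \<bullet> \<beta> = (\<Sum>k<Suc D. of_int (code_entry D B j k) * \<beta> $ k)"
  using assms by (simp add: hard_mat_def scalar_prod_def lessThan_atLeast0)

lemma row_hard_mat_last:
  assumes "\<beta> \<in> carrier_vec (Suc D)"
  shows "row (hard_mat D m B) m \<bullet> \<beta> =
    - (\<Sum>j<m. row (hard_mat D m B) j \<bullet> \<beta>) / real (balance D m)"
proof -
  have "row (hard_mat D m B) m \<bullet> \<beta> =
      (\<Sum>k<Suc D. (- (\<Sum>j<m. of_int (code_entry D B j k)) / real (balance D m)) * \<beta> $ k)"
    using assms by (simp add: hard_mat_def scalar_prod_def lessThan_atLeast0)
  also have "\<dots> = - (\<Sum>k<Suc D. \<Sum>j<m. of_int (code_entry D B j k) * \<beta> $ k) / real (balance D m)"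
    by (simp add: sum_distrib_right sum_negf sum_divide_distrib del: sum.lessThan_Suc)
  also have "\<dots> = - (\<Sum>j<m. \<Sum>k<Suc D. of_int (code_entry D B j k) * \<beta> $ k) / real (balance D m)"
    by (subst sum.swap) simp
  also have "\<dots> = - (\<Sum>j<m. row (hard_mat D m B) j \<bullet> \<beta>) / real (balance D m)"
    using assms by (simp add: row_hard_mat del: sum.lessThan_Suc)
  finally show ?thesis .
qed

lemma complexity_hard_mat:
  assumes "0 < m"
  shows "complexity (Matrix.vec (Suc m) (\<lambda>_. - 1)) (hard_mat D m B) = ennreal (real (balance D m))"
proof (rule complexity_balanced[OF hard_mat_carrier _ row_hard_mat_last _ _ assms])
  have "0 < balance D m" using assms by (simp add: balance_def)
  then show "1 \<le> real (balance D m)" by linarith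
  \<comment> \<open>Every row before the last ends in 1 or 2, so minus the last unit vector makes
    all of them negative.\<close>
  show "Matrix.vec (Suc D) (\<lambda>k. if k < D then 0 else - 1) \<in> carrier_vec (Suc D)" by simp
  show "row (hard_mat D m B) j \<bullet> Matrix.vec (Suc D) (\<lambda>k. if k < D then 0 else - 1) < 0"
    if "j < m" for j
    using that by (simp add: row_hard_mat code_entry_def)
qed

text \<open>Proper fractions occur only in the last row, with numerators of size at most
  \<open>2 m\<close> over \<open>8 (D + 1) m\<close>. Since \<open>8 \<le> m\<close>, the square of
  the number of entries bounds both.\<close>

lemma short_entries_hard_mat:
  assumes "8 \<le> m"
  shows "short_entries 2 (hard_mat D m B)"
  unfolding short_entries_def
proof (intro allI impI)
  fix j k
  assume "j < dim_row (hard_mat D m B)" "k < dim_col (hard_mat D m B)"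
  then have jk: "j < Suc m" "k < Suc D" by (simp_all add: hard_mat_def)
  define M where "M = int ((dim_row (hard_mat D m B) * dim_col (hard_mat D m B)) ^ 2)"
  have M: "M = int ((Suc m * Suc D) ^ 2)" by (simp add: M_def hard_mat_def)
  have "balance D m \<le> m * Suc D * (m * Suc D)"
    unfolding balance_def using assms by (intro mult_le_mono) auto
  also have "\<dots> \<le> (Suc m * Suc D) ^ 2"
    unfolding power2_eq_square by (intro mult_le_mono) auto
  finally have bal: "int (balance D m) \<le> M" unfolding M by linarith
  have "2 * m \<le> balance D m" unfolding balance_def by (intro mult_le_mono1) simp
  then have bal2: "int (2 * m) \<le> int (balance D m)" by linarith
  have ent: "\<bar>code_entry D B i k\<bar> \<le> 2" for i by (simp add: code_entry_def)
  have "\<exists>p q :: int. 0 < q \<and> q \<le> M \<and> \<bar>p\<bar> \<le> M \<and> hard_mat D m B $$ (j, k) = of_int p / of_int q"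
  proof (cases "j < m")
    case True
    show ?thesis
      using True jk ent[of j] bal bal2 assms
      by (intro exI[of _ "code_entry D B j k"] exI[of _ 1]) (auto simp: hard_mat_def)
  next
    case False
    then have "hard_mat D m B $$ (j, k) =
        of_int (- (\<Sum>i<m. code_entry D B i k)) / of_int (int (balance D m))"
      using jk by (simp add: hard_mat_def)
    moreover have "\<bar>\<Sum>i<m. code_entry D B i k\<bar> \<le> int (2 * m)"
      using order_trans[OF sum_abs sum_mono[of "{..<m}" "\<lambda>i. \<bar>code_entry D B i k\<bar>" "\<lambda>_. 2"]] ent by simp
    ultimately show ?thesis
      using bal bal2 assms
      by (intro exI[of _ "- (\<Sum>i<m. code_entry D B i k)"] exI[of _ "int (balance D m)"]) auto
  qed
  then show "\<exists>p q :: int. 0 < q \<and> q \<le> int ((dim_row (hard_mat D m B) * dim_col (hard_mat D m B)) ^ 2) \<and>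
      \<bar>p\<bar> \<le> int ((dim_row (hard_mat D m B) * dim_col (hard_mat D m B)) ^ 2) \<and>
      hard_mat D m B $$ (j, k) = of_int p / of_int q"
    by (simp add: M_def)
qed

section \<open>Values of the rows at the probes\<close>

text \<open>Distinct numbers below \<open>2 ^ D\<close> differ in one of the first \<open>D\<close>
  binary digits. That digit contributes -1 and the other \<open>D - 1\<close> digits at most 1
  each.\<close>

lemma sign_code_product:
  fixes i j D :: nat
  defines "s \<equiv> (\<Sum>k<D. (if bit j k then 1 else - 1) * (if bit i k then 1 else - 1) :: real)"
  assumes "i < 2 ^ D" "j < 2 ^ D"
  shows "i = j \<Longrightarrow> s = real D" "i \<noteq> j \<Longrightarrow> s \<le> real D - 2" "- real D \<le> s"
proof -
  let ?f = "\<lambda>k. (if bit j k then 1 else - 1) * (if bit i k then 1 else - 1) :: real"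
  show "s = real D" if "i = j"
  proof -
    have "s = (\<Sum>k<D. 1)" unfolding s_def using that by (intro sum.cong) auto
    then show ?thesis by simp
  qed
  show "s \<le> real D - 2" if "i \<noteq> j"
  proof -
    have "\<exists>k<D. bit i k \<noteq> bit j k"
    proof (rule ccontr)
      assume "\<not> (\<exists>k<D. bit i k \<noteq> bit j k)"
      then have "take_bit D i = take_bit D j" by (auto intro!: bit_eqI simp: bit_take_bit_iff)
      with assms that show False by (simp add: take_bit_nat_eq_self)
    qed
    then obtain k where k: "k < D" "bit i k \<noteq> bit j k" by blast
    have "s = ?f k + (\<Sum>l\<in>{..<D} - {k}. ?f l)"
      unfolding s_def using k by (intro sum.remove) auto
    also have "(\<Sum>l\<in>{..<D} - {k}. ?f l) \<le> (\<Sum>l\<in>{..<D} - {k}. 1)"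
      by (intro sum_mono) auto
    also have "(\<Sum>l\<in>{..<D} - {k}. 1 :: real) = real D - 1"
      using k by (simp add: of_nat_diff)
    also have "?f k = - 1" using k by auto
    finally show ?thesis by simp
  qed
  have "(\<Sum>k<D. - 1) \<le> s" unfolding s_def by (intro sum_mono) auto
  then show "- real D \<le> s" by simp
qed

text \<open>The value is \<open>T * (s + c * (1 - D))\<close> with sign product \<open>s\<close> and
  last entry \<open>c\<close>. For \<open>i = j\<close>, \<open>s = D\<close> gives the factor 1 if
  \<open>c = 1\<close>, and \<open>2 - D\<close> if \<open>c = 2\<close>, which is at most -1
  because \<open>D \<ge> 3\<close>. For \<open>i \<noteq> j\<close>, \<open>s \<le> D - 2\<close>
  leaves at most -1 already with \<open>c = 1\<close>. The lower bound combines
  \<open>s \<ge> - D\<close> with \<open>c \<le> 2\<close>.\<close>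

lemma row_hard_mat_probe:
  fixes T :: real
  assumes T: "0 \<le> T" and D: "3 \<le> D" and i: "i < 2 ^ D" and j: "j < 2 ^ D" "j < m"
  shows "i = j \<Longrightarrow> j \<in> B \<Longrightarrow> row (hard_mat D m B) j \<bullet> probe D T i = T"
    and "i \<noteq> j \<or> j \<notin> B \<Longrightarrow> row (hard_mat D m B) j \<bullet> probe D T i \<le> - T"
    and "- (3 * real D * T) \<le> row (hard_mat D m B) j \<bullet> probe D T i"
proof -
  define s :: real where "s = (\<Sum>k<D. (if bit j k then 1 else - 1) * (if bit i k then 1 else - 1))"
  define c :: real where "c = (if j \<in> B then 1 else 2)"
  have "row (hard_mat D m B) j \<bullet> probe D T i =
      (\<Sum>k<D. T * ((if bit j k then 1 else - 1) * (if bit i k then 1 else - 1))) + c * (T * (1 - real D))"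
    using j by (auto simp: row_hard_mat probe_carrier probe_def code_entry_def c_def intro!: sum.cong)
  also have "\<dots> = T * (s + c * (1 - real D))"
    by (simp add: s_def sum_distrib_left[symmetric] algebra_simps)
  finally have row: "row (hard_mat D m B) j \<bullet> probe D T i = T * (s + c * (1 - real D))" .
  note s = sign_code_product[OF i j(1), folded s_def]
  have D': "3 \<le> real D" using D by simp
  show "row (hard_mat D m B) j \<bullet> probe D T i = T" if "i = j" "j \<in> B"
    unfolding row using that s(1) by (simp add: c_def)
  show "row (hard_mat D m B) j \<bullet> probe D T i \<le> - T" if "i \<noteq> j \<or> j \<notin> B"
  proof -
    have "s + c * (1 - real D) \<le> - 1"
      using that s D' by (cases "i = j"; cases "j \<in> B") (auto simp: c_def)
    from mult_left_mono[OF this T] show ?thesis by (simp add: row)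
  qed
  have "- (3 * real D) \<le> s + c * (1 - real D)"
    using s(3) D' by (auto simp: c_def)
  from mult_left_mono[OF this T] show "- (3 * real D * T) \<le> row (hard_mat D m B) j \<bullet> probe D T i"
    by (simp add: row mult_ac)
qed

section \<open>Logistic loss at the probes\<close>

lemma ln_one_plus_exp_bounds:
  fixes a :: real
  shows "0 \<le> ln (1 + exp a)" "a \<le> ln (1 + exp a)" "ln (1 + exp a) \<le> exp a"
    "0 \<le> a \<Longrightarrow> ln (1 + exp a) \<le> a + 1"
proof -
  show "0 \<le> ln (1 + exp a)" by (intro ln_ge_zero) simp
  show "a \<le> ln (1 + exp a)" by (subst ln_ge_iff) (auto simp: add_pos_pos)
  show "ln (1 + exp a) \<le> exp a" by (intro ln_add_one_self_le_self) simp
  show "ln (1 + exp a) \<le> a + 1" if "0 \<le> a"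
  proof -
    have "1 + exp a \<le> 2 * exp a" using that by simp
    also have "\<dots> \<le> exp 1 * exp a" using exp_ge_add_one_self[of 1] by (intro mult_right_mono) auto
    finally have "1 + exp a \<le> exp (a + 1)" by (simp add: exp_add mult.commute)
    then have "ln (1 + exp a) \<le> ln (exp (a + 1))"
      by (subst ln_le_cancel_iff) (auto simp: add_pos_pos)
    then show ?thesis by simp
  qed
qed

text \<open>Row \<open>i\<close> alone contributes at least \<open>T\<close>, and no term is
  negative.\<close>

lemma logistic_loss_hard_mat_ge:
  assumes "0 \<le> T" "3 \<le> D" "m \<le> 2 ^ D" "i < m" "i \<in> B"
  shows "T \<le> logistic_loss (hard_mat D m B) (probe D T i)"
proof -
  have "T \<le> ln (1 + exp (row (hard_mat D m B) i \<bullet> probe D T i))"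
    using row_hard_mat_probe(1)[of T D i i m B] assms ln_one_plus_exp_bounds(2)[of T] by simp
  also have "\<dots> \<le> logistic_loss (hard_mat D m B) (probe D T i)"
    unfolding logistic_loss_def using assms hard_mat_carrier[of D m B]
    by (intro member_le_sum[where f = "\<lambda>r. ln (1 + exp (row (hard_mat D m B) r \<bullet> probe D T i))"])
       (auto simp: ln_one_plus_exp_bounds)
  finally show ?thesis .
qed

text \<open>The first \<open>m\<close> rows together contribute at most
  \<open>m * exp (- T) \<le> 1\<close>. The balancing row may have a positive value, but one of at
  most \<open>3 T / 8\<close>, hence a loss of at most \<open>3 T / 8 + 1\<close>.\<close>

lemma logistic_loss_hard_mat_le:
  assumes T: "16 \<le> T" "real m \<le> T" and D: "3 \<le> D" and m: "m \<le> 2 ^ D" "i < m" and i: "i \<notin> B"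
  shows "logistic_loss (hard_mat D m B) (probe D T i) \<le> T / 2"
proof -
  define v where "v j = row (hard_mat D m B) j \<bullet> probe D T i" for j
  have up: "v j \<le> - T" if "j < m" for j
    unfolding v_def by (rule row_hard_mat_probe(2)) (use that assms in auto)
  have lo: "- (3 * real D * T) \<le> v j" if "j < m" for j
    unfolding v_def by (rule row_hard_mat_probe(3)) (use that assms in auto)
  have "(\<Sum>j<m. ln (1 + exp (v j))) \<le> (\<Sum>j<m. exp (- T))"
  proof (rule sum_mono)
    fix j assume "j \<in> {..<m}"
    then have "exp (v j) \<le> exp (- T)" using up by simp
    then show "ln (1 + exp (v j)) \<le> exp (- T)" using ln_one_plus_exp_bounds(3)[of "v j"] by linarith
  qed
  also have "\<dots> = real m / exp T" by (simp add: exp_minus field_simps)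
  also have "\<dots> \<le> 1"
  proof -
    have "real m \<le> exp T" using T exp_ge_add_one_self[of T] by linarith
    then show ?thesis by (simp add: divide_le_eq)
  qed
  finally have main: "(\<Sum>j<m. ln (1 + exp (v j))) \<le> 1" .
  have "- (\<Sum>j<m. v j) = (\<Sum>j<m. - v j)" by (simp add: sum_negf)
  also have "\<dots> \<le> (\<Sum>j<m. 3 * real D * T)" using lo by (intro sum_mono) fastforce
  also have "\<dots> = 3 * real D * T * real m" by simp
  finally have "v m \<le> 3 * real D * T * real m / real (balance D m)"
    unfolding v_def row_hard_mat_last[OF probe_carrier] by (intro divide_right_mono) auto
  also have "\<dots> = 3 * real D * T * real m / (8 * (1 + real D) * real m)"
    by (simp add: balance_def)
  also have "\<dots> = 3 * real D * T / (8 * (1 + real D))"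
    using m by (intro nonzero_mult_divide_mult_cancel_right) simp
  also have "\<dots> = 3 / 8 * T * (real D / (1 + real D))" by simp
  also have "\<dots> \<le> 3 / 8 * T * 1"
    using T by (intro mult_left_mono) auto
  finally have vm: "v m \<le> 3 / 8 * T" by simp
  then have "exp (v m) \<le> exp (3 / 8 * T)" by simp
  then have "ln (1 + exp (v m)) \<le> ln (1 + exp (3 / 8 * T))"
    by (subst ln_le_cancel_iff) (auto simp: add_pos_pos)
  also have "\<dots> \<le> 3 / 8 * T + 1" using T by (intro ln_one_plus_exp_bounds(4)) simp
  finally have "ln (1 + exp (v m)) \<le> 3 / 8 * T + 1" .
  with main have "(\<Sum>j<Suc m. ln (1 + exp (v j))) \<le> 3 / 8 * T + 2" by simp
  \<comment> \<open>The constant 16 comes from here: the 2 has to fit into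
    \<open>T / 8\<close>.\<close>
  also have "\<dots> \<le> T / 2" using T by simp
  finally show ?thesis
    using hard_mat_carrier[of D m B] by (simp add: logistic_loss_def v_def)
qed

section \<open>Counting the sets that a bit string can describe\<close>

text \<open>For \<open>p\<close> with values in \<open>[0, 1]\<close> this is the l1-distance on
  \<open>A\<close> between \<open>p\<close> and the indicator of \<open>B\<close>, or the expected
  number of errors when membership of \<open>i\<close> is guessed with probability
  \<open>p i\<close>.\<close>

definition soft_error :: "nat set \<Rightarrow> (nat \<Rightarrow> real) \<Rightarrow> nat set \<Rightarrow> real" where
  "soft_error A p B = (\<Sum>i\<in>A. if i \<in> B then 1 - p i else p i)"

text \<open>By convexity the exponential lies below its chord through \<open>(0, 1)\<close> and
  \<open>(1, 1/2)\<close>.\<close>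

lemma two_powr_minus_le_chord:
  fixes e :: real
  assumes "0 \<le> e" "e \<le> 1"
  shows "2 powr (- e) \<le> 1 - e / 2"
  using convex_onD[OF exp_convex, of e 0 "- ln 2"] assms
  by (simp add: powr_def exp_minus field_simps)

text \<open>An exponential Markov inequality: each counted \<open>B\<close> has weight
  \<open>2 powr (- soft_error A p B)\<close> at least \<open>2 powr (- r)\<close>, while all subsets
  together weigh at most \<open>(3 / 2) ^ card A\<close>.\<close>

lemma card_small_soft_error:
  assumes A: "finite A" and p: "\<And>i. i \<in> A \<Longrightarrow> 0 \<le> p i \<and> p i \<le> 1"
  shows "real (card {B \<in> Pow A. soft_error A p B \<le> r}) \<le> 2 powr r * (3 / 2) ^ card A"
proof -
  let ?e = "\<lambda>B i. if i \<in> B then 1 - p i else p i"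
  \<comment> \<open>Bounding each factor \<open>2\<^bsup>-e\<^esup>\<close> by its chord makes the sum over all \<open>B\<close> factor exactly, with every
    factor equal to \<open>3/2\<close> whatever \<open>p\<close> is.\<close>
  have weight: "2 powr (- soft_error A p B) \<le> (\<Prod>i\<in>B. (1 + p i) / 2) * (\<Prod>i\<in>A - B. 1 - p i / 2)"
    if B: "B \<in> Pow A" for B
  proof -
    have "2 powr (- soft_error A p B) = (\<Prod>i\<in>A. 2 powr (- ?e B i))"
      using A by (simp add: soft_error_def powr_sum flip: sum_negf)
    also have "\<dots> \<le> (\<Prod>i\<in>A. 1 - ?e B i / 2)"
      using p by (intro prod_mono conjI two_powr_minus_le_chord) auto
    also have "\<dots> = (\<Prod>i\<in>B. 1 - ?e B i / 2) * (\<Prod>i\<in>A - B. 1 - ?e B i / 2)"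
      using B A by (simp add: prod.subset_diff[of B A] mult.commute)
    also have "\<dots> = (\<Prod>i\<in>B. (1 + p i) / 2) * (\<Prod>i\<in>A - B. 1 - p i / 2)"
      by (intro arg_cong2[where f = "(*)"] prod.cong) (auto simp: field_simps)
    finally show ?thesis .
  qed
  have "real (card {B \<in> Pow A. soft_error A p B \<le> r}) * 2 powr (- r) =
      (\<Sum>B\<in>{B \<in> Pow A. soft_error A p B \<le> r}. 2 powr (- r))" by simp
  also have "\<dots> \<le> (\<Sum>B\<in>{B \<in> Pow A. soft_error A p B \<le> r}. 2 powr (- soft_error A p B))"
    by (intro sum_mono) simp
  also have "\<dots> \<le> (\<Sum>B\<in>Pow A. 2 powr (- soft_error A p B))"
    using A by (intro sum_mono2) auto
  also have "\<dots> \<le> (\<Sum>B\<in>Pow A. (\<Prod>i\<in>B. (1 + p i) / 2) * (\<Prod>i\<in>A - B. 1 - p i / 2))"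
    by (intro sum_mono weight)
  also have "\<dots> = (\<Prod>i\<in>A. (1 + p i) / 2 + (1 - p i / 2))"
    using A by (simp add: prod_add)
  also have "\<dots> = (\<Prod>i\<in>A. 3 / 2)"
    by (intro prod.cong) (auto simp: field_simps)
  also have "\<dots> = (3 / 2) ^ card A" by simp
  finally have "real (card {B \<in> Pow A. soft_error A p B \<le> r}) * 2 powr (- r) \<le> (3 / 2) ^ card A" .
  then show ?thesis by (simp add: powr_minus field_simps)
qed

lemma card_bool_lists_le: "card {s :: bool list. length s \<le> b} \<le> 2 ^ Suc b"
proof -
  have "card {s :: bool list. set s \<subseteq> UNIV \<and> length s \<le> b} = (\<Sum>i\<le>b. 2 ^ i)"
    by (subst card_lists_length_le) auto
  also have "\<dots> \<le> 2 ^ Suc b" by (induction b) auto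
  finally show ?thesis by simp
qed

lemma finite_bool_lists_le: "finite {s :: bool list. length s \<le> b}"
  using finite_lists_length_le[of "UNIV :: bool set" b] by simp

text \<open>At most \<open>2 ^ (b + 1)\<close> strings have to serve \<open>2 ^ m\<close> sets. With
  \<open>log 2 (3 / 2) \<le> 3 / 5\<close>, taking logarithms leaves
  \<open>m * (1 - 1/3 - 3/5) = m / 15 \<le> b + 1\<close>.\<close>

lemma soft_index_lower_bound:
  fixes p :: "bool list \<Rightarrow> nat \<Rightarrow> real"
  assumes p: "\<And>s i. 0 \<le> p s i \<and> p s i \<le> 1"
    and code: "\<And>B. B \<subseteq> {..<m} \<Longrightarrow> \<exists>s. length s \<le> b \<and> soft_error {..<m} (p s) B \<le> real m / 3"
  shows "real m \<le> 15 * (real b + 1)"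
proof -
  define F where "F = {s :: bool list. length s \<le> b}"
  define C where "C s = {B \<in> Pow {..<m}. soft_error {..<m} (p s) B \<le> real m / 3}" for s
  have F: "finite F" "card F \<le> 2 ^ Suc b"
    unfolding F_def by (rule finite_bool_lists_le card_bool_lists_le)+
  have "Pow {..<m} \<subseteq> (\<Union>s\<in>F. C s)"
    using code by (fastforce simp: F_def C_def)
  then have "card (Pow {..<m}) \<le> card (\<Union>s\<in>F. C s)"
    using F by (intro card_mono) (auto simp: C_def)
  also have "\<dots> \<le> (\<Sum>s\<in>F. card (C s))" using F by (intro card_UN_le)
  finally have "2 ^ m \<le> (\<Sum>s\<in>F. card (C s))" by (simp add: card_Pow)
  then have "2 ^ m \<le> (\<Sum>s\<in>F. real (card (C s)))"
    by (metis of_nat_le_iff of_nat_numeral of_nat_power of_nat_sum)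
  also have "\<dots> \<le> (\<Sum>s\<in>F. 2 powr (real m / 3) * (3 / 2) ^ m)"
  proof (rule sum_mono)
    fix s
    show "real (card (C s)) \<le> 2 powr (real m / 3) * (3 / 2) ^ m"
      using card_small_soft_error[of "{..<m}" "p s" "real m / 3"] p by (simp add: C_def)
  qed
  also have "\<dots> = real (card F) * (2 powr (real m / 3) * (3 / 2) ^ m)" by simp
  also have "\<dots> \<le> 2 ^ Suc b * (2 powr (real m / 3) * (3 / 2) ^ m)"
    using F(2) by (intro mult_right_mono) (auto simp flip: of_nat_le_iff[where 'a = real])
  \<comment> \<open>Fifth powers are compared: \<open>243 / 32 \<le> 8\<close>.\<close>
  also have "(3 / 2 :: real) ^ m \<le> 2 powr (3 / 5 * real m)"
  proof -
    have "((2::real) powr (3 / 5)) ^ Suc 4 = 2 ^ 3"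
      using powr_powr[of 2 "3 / 5 :: real" 5] powr_realpow[of "2 powr (3 / 5) :: real" 5] by simp
    then have "(3 / 2 :: real) ^ Suc 4 \<le> (2 powr (3 / 5)) ^ Suc 4"
      by (simp add: eval_nat_numeral)
    then have "(3 / 2 :: real) \<le> 2 powr (3 / 5)"
      by (rule power_le_imp_le_base) simp
    then have "(3 / 2 :: real) ^ m \<le> (2 powr (3 / 5)) ^ m" by (intro power_mono) auto
    then show ?thesis by (simp add: powr_powr flip: powr_realpow)
  qed
  finally have "(2::real) powr real m \<le> 2 powr (real (Suc b) + (real m / 3 + 3 / 5 * real m))"
    unfolding powr_add by (simp add: powr_realpow mult_left_mono del: power_Suc of_nat_Suc)
  then have "real m \<le> real (Suc b) + (real m / 3 + 3 / 5 * real m)" by simp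
  then show ?thesis by (simp add: field_simps)
qed

section \<open>From a data structure to a bit string\<close>

lemma measure_answer:
  assumes Q: "query_procedure Q" and A: "A \<in> sets borel"
  shows "measure (answer S Q \<beta>) A = measure_pmf.expectation S (\<lambda>s. measure (Q s \<beta>) A)"
proof -
  have "(\<lambda>s. Q s \<beta>) \<in> measurable (measure_pmf S) (subprob_algebra borel)"
    using Q by (auto simp: query_procedure_def space_prob_algebra space_subprob_algebra
        prob_space_imp_subprob_space)
  then show ?thesis
    unfolding answer_def using A by (rule measure_pmf.measure_bind)
qed

lemma pmf_exists_ge_expectation:
  fixes f :: "'a \<Rightarrow> real"
  assumes "integrable (measure_pmf S) f" "a \<le> measure_pmf.expectation S f"
  shows "\<exists>s\<in>set_pmf S. a \<le> f s"
proof (rule ccontr)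
  assume "\<not> ?thesis"
  then have "AE s in measure_pmf S. f s < a" by (auto simp: AE_measure_pmf_iff not_le)
  then have "measure_pmf.expectation S f < a"
    using assms(1) by (intro measure_pmf.expectation_less)
  with assms(2) show False by simp
qed

text \<open>The guarantee holds for each probe separately, so a stored string need not be good for
  all of them. Summing the success probabilities over the \<open>m\<close> probes and averaging over
  the stored string yields one string with sum at least \<open>2 m / 3\<close>. Thresholding its
  answers at \<open>3 T / 4\<close> errs only when an answer misses its interval.\<close>

lemma decode_from_data_structure:
  assumes Q: "query_procedure Q" and S: "stored_in_bits b S"
    and approx: "approximates_loss (1 / 4) (hard_mat D m B) S Q"
    and T: "16 \<le> T" "real m \<le> T" and D: "3 \<le> D" and m: "m \<le> 2 ^ D"
  shows "\<exists>s. length s \<le> b \<and>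
    soft_error {..<m} (\<lambda>i. measure (Q s (probe D T i)) {3 / 4 * T..}) B \<le> real m / 3"
proof -
  let ?L = "\<lambda>i. logistic_loss (hard_mat D m B) (probe D T i)"
  define I where "I i = {(1 - 1 / 4) * ?L i .. (1 + 1 / 4) * ?L i}" for i
  define f where "f s = (\<Sum>i<m. measure (Q s (probe D T i)) (I i))" for s
  have prob: "prob_space (Q s \<beta>)" and sets: "sets (Q s \<beta>) = sets borel" for s \<beta>
    using Q by (auto simp: query_procedure_def space_prob_algebra)
  have integrable: "integrable (measure_pmf S) (\<lambda>s. measure (Q s \<beta>) A)" for \<beta> A
    using prob_space.prob_le_1[OF prob]
    by (intro measure_pmf.integrable_const_bound[where B = 1]) auto
  have "2 / 3 \<le> measure_pmf.expectation S (\<lambda>s. measure (Q s (probe D T i)) (I i))" if "i < m" for i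
    using approx probe_carrier[of D T i] hard_mat_carrier[of D m B] measure_answer[OF Q, of "I i" S]
    by (auto simp: approximates_loss_def I_def)
  then have "(\<Sum>i<m. 2 / 3) \<le> (\<Sum>i<m. measure_pmf.expectation S (\<lambda>s. measure (Q s (probe D T i)) (I i)))"
    by (intro sum_mono) auto
  then have "2 / 3 * real m \<le> measure_pmf.expectation S f"
    unfolding f_def using integrable by (subst Bochner_Integration.integral_sum) auto
  moreover have "integrable (measure_pmf S) f"
    unfolding f_def using integrable by (intro Bochner_Integration.integrable_sum)
  ultimately obtain s where s: "s \<in> set_pmf S" "2 / 3 * real m \<le> f s"
    using pmf_exists_ge_expectation by blast
  let ?p = "\<lambda>i. measure (Q s (probe D T i)) {3 / 4 * T..}"
  have "soft_error {..<m} ?p B \<le> (\<Sum>i<m. 1 - measure (Q s (probe D T i)) (I i))"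
    unfolding soft_error_def
  proof (rule sum_mono)
    fix i assume "i \<in> {..<m}"
    then have i: "i < m" by simp
    interpret prob_space "Q s (probe D T i)" by (rule prob)
    have space: "space (Q s (probe D T i)) = UNIV"
      using sets_eq_imp_space_eq[OF sets] by simp
    show "(if i \<in> B then 1 - ?p i else ?p i) \<le> 1 - measure (Q s (probe D T i)) (I i)"
    proof (cases "i \<in> B")
      case True
      have "T \<le> ?L i" using True T D m i by (intro logistic_loss_hard_mat_ge) auto
      then have "measure (Q s (probe D T i)) (I i) \<le> ?p i"
        by (intro finite_measure_mono) (auto simp: I_def sets)
      with True show ?thesis by simp
    next
      case False
      have "?L i \<le> T / 2" using False T D m i by (intro logistic_loss_hard_mat_le) auto
      \<comment> \<open>The interval ends at or below \<open>5/4 * T/2 = 5 T / 8\<close>, short of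
        the threshold.\<close>
      then have "I i \<inter> {3 / 4 * T..} = {}" using T by (auto simp: I_def)
      then have "measure (Q s (probe D T i)) (I i) + ?p i = measure (Q s (probe D T i)) (I i \<union> {3 / 4 * T..})"
        by (intro finite_measure_Union[symmetric]) (auto simp: I_def sets)
      also have "\<dots> \<le> 1" by (rule prob_le_1)
      finally show ?thesis using False by simp
    qed
  qed
  also have "\<dots> = real m - f s" by (simp add: f_def sum_subtractf)
  also have "\<dots> \<le> real m / 3" using s(2) by simp
  finally show ?thesis
    using s(1) S by (auto simp: stored_in_bits_def)
qed

text \<open>\<open>Q\<close> is fixed before \<open>B\<close>. If every \<open>B\<close> had a
  structure with fewer than \<open>m / 30\<close> bits, one common decoder would recover all sets
  from short strings, against the counting bound.\<close>

lemma data_structure_lower_bound: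
  assumes Q: "query_procedure Q" and D: "3 \<le> D" "m \<le> 2 ^ D" and m: "30 \<le> m"
  shows "\<exists>B. \<forall>S b. stored_in_bits b S \<and> approximates_loss (1 / 4) (hard_mat D m B) S Q \<longrightarrow>
    real m / 30 \<le> real b"
proof (rule ccontr)
  assume "\<not> ?thesis"
  then have bad: "\<exists>S b. stored_in_bits b S \<and> approximates_loss (1 / 4) (hard_mat D m B) S Q \<and>
      real b < real m / 30" for B
    by (meson not_le)
  \<comment> \<open>the largest natural number strictly below \<open>m / 30\<close>\<close>
  define r where "r = nat (\<lceil>real m / 30\<rceil> - 1)"
  have r: "real r < real m / 30" "\<And>b. real b < real m / 30 \<Longrightarrow> b \<le> r"
    using m unfolding r_def by linarith+
  \<comment> \<open>The scale \<open>T = m\<close> satisfies both \<open>16 \<le> T\<close> and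
    \<open>m \<le> T\<close>.\<close>
  let ?p = "\<lambda>s i. measure (Q s (probe D (real m) i)) {3 / 4 * real m..}"
  have "real m \<le> 15 * (real r + 1)"
  proof (rule soft_index_lower_bound[of ?p])
    fix s i
    have "prob_space (Q s (probe D (real m) i))"
      using Q by (auto simp: query_procedure_def space_prob_algebra)
    then show "0 \<le> ?p s i \<and> ?p s i \<le> 1" by (simp add: prob_space.prob_le_1)
  next
    fix B
    obtain S b where "stored_in_bits b S" "approximates_loss (1 / 4) (hard_mat D m B) S Q"
      "real b < real m / 30" using bad by blast
    then obtain s where "length s \<le> b" "soft_error {..<m} (?p s) B \<le> real m / 3"
      using decode_from_data_structure[OF Q, of b S D m B "real m"] D m by auto
    then show "\<exists>s. length s \<le> r \<and> soft_error {..<m} (?p s) B \<le> real m / 3"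
      using r(2)[OF \<open>real b < real m / 30\<close>] by (meson order_trans)
  qed
  \<comment> \<open>As \<open>r < m / 30\<close>, the right-hand side is below
    \<open>m / 2 + 15\<close>, which forces \<open>m < 30\<close>.\<close>
  with r(1) m show False by simp
qed

section \<open>Choice of parameters and conclusion\<close>

text \<open>For \<open>2 ^ l < n \<le> 2 ^ (l + 1)\<close> the choice is \<open>D = l + 1\<close>;
  then \<open>3 ln n \<ge> 2 l \<ge> l + 2\<close> because \<open>ln 2 \<ge> 2 / 3\<close>.\<close>

lemma exists_code_length:
  fixes n :: nat
  assumes "16 \<le> n"
  shows "\<exists>D. 3 \<le> D \<and> Suc D \<le> n \<and> n \<le> 2 ^ D \<and> real (Suc D) \<le> 3 * ln (real n)"
proof -
  obtain l where l: "2 ^ l < n" "n \<le> 2 ^ (l + 1)"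
    using ex_power_ivl2[of 2 n] assms by auto
  have "(2::nat) ^ 4 \<le> 2 ^ (l + 1)" using assms l(2) by simp
  then have l3: "3 \<le> l" by (subst (asm) power_increasing_iff) auto
  have "l + 1 \<le> 2 ^ l" by (simp add: Suc_leI)
  with l(1) have ln: "Suc (Suc l) \<le> n" by linarith
  have "real l * (2 / 3) \<le> real l * ln 2"
    using ln2_ge_two_thirds by (intro mult_left_mono) auto
  also have "\<dots> = ln (real (2 ^ l))" by (simp add: ln_realpow)
  also have "\<dots> \<le> ln (real n)" 
  proof (subst ln_le_cancel_iff)
    show "real (2 ^ l) \<le> real n" using l(1) by (intro of_nat_mono) simp
  qed (use assms in simp_all)
  finally have "real (Suc (Suc l)) \<le> 3 * ln (real n)" using l3 by simp
  with l ln l3 show ?thesis by (intro exI[of _ "Suc l"]) auto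
qed

text \<open>The suppressed logarithms appear as a \<open>k\<close>-th power. The lower bound on
  \<open>\<mu>\<close> keeps the space bound from being met trivially by a matrix of small
  complexity. The space bound actually obtained is \<open>m / 30\<close>, while
  \<open>d * \<mu> = 8 (D + 1)^2 m\<close>, whence \<open>k = 2\<close>.\<close>

theorem theorem2:
  shows "\<exists>(n\<^sub>0::nat) (\<epsilon>\<^sub>0::real) (c::real) (k::nat) (C::nat). \<epsilon>\<^sub>0 > 0 \<and> c > 0 \<and>
    (\<forall>n::nat. n > 0 \<and> n \<ge> n\<^sub>0 \<longrightarrow>
      (\<exists>d::nat. 1 \<le> d \<and> d \<le> n \<and>
        (\<forall>Q. query_procedure Q \<longrightarrow>
          (\<exists>X \<in> carrier_mat n d. \<exists>\<mu>::real. 0 \<le> \<mu> \<and>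
            short_entries C X \<and>
            complexity (Matrix.vec n (\<lambda>_. - 1)) X = ennreal \<mu> \<and>
            c * real n / ln (real n) ^ k \<le> \<mu> \<and>
            (\<forall>S b. stored_in_bits b S \<and> approximates_loss \<epsilon>\<^sub>0 X S Q \<longrightarrow>
               c * (real d * \<mu>) / ln (real n + real d + \<mu>) ^ k \<le> real b)))))"
proof -
  \<comment> \<open>The space bound below needs \<open>8 * c * 3^2 \<le> 1 / 30\<close>, that is,
    \<open>c \<le> 1 / 2160\<close>.\<close>
  define c :: real where "c = 1 / 3000"
  have main: "\<exists>d::nat. 1 \<le> d \<and> d \<le> n \<and>
        (\<forall>Q. query_procedure Q \<longrightarrow>
          (\<exists>X \<in> carrier_mat n d. \<exists>\<mu>::real. 0 \<le> \<mu> \<and>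
            short_entries 2 X \<and>
            complexity (Matrix.vec n (\<lambda>_. - 1)) X = ennreal \<mu> \<and>
            c * real n / ln (real n) ^ 2 \<le> \<mu> \<and>
            (\<forall>S b. stored_in_bits b S \<and> approximates_loss (1 / 4) X S Q \<longrightarrow>
               c * (real d * \<mu>) / ln (real n + real d + \<mu>) ^ 2 \<le> real b)))"
    if n: "100 \<le> n" for n
  proof -
    obtain D where D: "3 \<le> D" "Suc D \<le> n" "n \<le> 2 ^ D" "real (Suc D) \<le> 3 * ln (real n)"
      using exists_code_length[of n] n by auto
    obtain m where nm: "n = Suc m" using n by (cases n) auto
    define \<mu> where "\<mu> = real (balance D m)"
    have \<mu>: "\<mu> = 8 * real (Suc D) * real m" by (simp add: \<mu>_def balance_def)
    have ln1: "1 \<le> ln (real n)" using D by simp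
    have "c * real n / ln (real n) ^ 2 \<le> c * real n / 1"
      using ln1 by (intro divide_left_mono) (auto simp: c_def)
    also have "\<dots> \<le> 1 * real m" using nm n by (simp add: c_def)
    also have "\<dots> \<le> \<mu>" unfolding \<mu> by (intro mult_right_mono) auto
    finally have large: "c * real n / ln (real n) ^ 2 \<le> \<mu>" .
    have "ln (real n) \<le> ln (real n + real (Suc D) + \<mu>)"
      using n by (subst ln_le_cancel_iff) (auto simp: \<mu> intro!: add_pos_nonneg add_nonneg_nonneg)
    then have "c * (real (Suc D) * \<mu>) / ln (real n + real (Suc D) + \<mu>) ^ 2
        \<le> c * (real (Suc D) * \<mu>) / ln (real n) ^ 2"
      using ln1 by (intro divide_left_mono power_mono mult_pos_pos) (auto simp: c_def \<mu>)
    \<comment> \<open>One factor \<open>D + 1\<close> comes from the dimension, one from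
      \<open>\<mu>\<close>; each is at most \<open>3 ln n\<close>.\<close>
    also have "\<dots> = 8 * c * real m * (real (Suc D) / ln (real n)) ^ 2"
      by (simp add: \<mu> power2_eq_square power_divide)
    also have "\<dots> \<le> 8 * c * real m * 3 ^ 2"
      using D(4) ln1 by (intro mult_left_mono power_mono) (auto simp: c_def divide_le_eq)
    also have "\<dots> \<le> real m / 30" by (simp add: c_def)
    finally have bits: "c * (real (Suc D) * \<mu>) / ln (real n + real (Suc D) + \<mu>) ^ 2 \<le> real m / 30" .
    show ?thesis
    proof (intro exI[of _ "Suc D"] conjI allI impI)
      fix Q assume "query_procedure Q"
      then obtain B where B: "\<And>S b. stored_in_bits b S \<and>
          approximates_loss (1 / 4) (hard_mat D m B) S Q \<Longrightarrow> real m / 30 \<le> real b"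
        using data_structure_lower_bound[of Q D m] D nm n by auto
      show "\<exists>X\<in>carrier_mat n (Suc D). \<exists>\<mu>::real. 0 \<le> \<mu> \<and> short_entries 2 X \<and>
          complexity (Matrix.vec n (\<lambda>_. - 1)) X = ennreal \<mu> \<and>
          c * real n / ln (real n) ^ 2 \<le> \<mu> \<and>
          (\<forall>S b. stored_in_bits b S \<and> approximates_loss (1 / 4) X S Q \<longrightarrow>
             c * (real (Suc D) * \<mu>) / ln (real n + real (Suc D) + \<mu>) ^ 2 \<le> real b)"
      proof (intro bexI[of _ "hard_mat D m B"] exI[of _ \<mu>] conjI allI impI)
        show "complexity (Matrix.vec n (\<lambda>_. - 1)) (hard_mat D m B) = ennreal \<mu>"
          unfolding nm \<mu>_def using nm n by (intro complexity_hard_mat) auto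
        show "short_entries 2 (hard_mat D m B)" using nm n by (intro short_entries_hard_mat) auto
        show "hard_mat D m B \<in> carrier_mat n (Suc D)" by (simp add: nm hard_mat_carrier)
        show "c * (real (Suc D) * \<mu>) / ln (real n + real (Suc D) + \<mu>) ^ 2 \<le> real b"
          if "stored_in_bits b S \<and> approximates_loss (1 / 4) (hard_mat D m B) S Q" for S b
          using bits B[OF that] by linarith
      qed (use large in \<open>auto simp: \<mu>\<close>)
    qed (use D in auto)
  qed
  show ?thesis
    using main
    by (intro exI[of _ "100::nat"] exI[of _ "1 / 4 :: real"] exI[of _ c] exI[of _ "2::nat"] exI[of _ "2::nat"])
      (auto simp: c_def)
qed

end
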